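(* Let $N=\frac{-1+\sqrt{2}}{2}$ and let $r$ be an odd positive integer. Choosing at each step the smallest allowed positive integer in the following procedure — $a_r$ the smallest integer with $a_r\ge 1+\lfloor N+1\rfloor$, $s_r=1-\frac{N+1}{a_r}$, and for $i=r-1,\ldots,1$: if $i$ is odd, $a_i=1+\left\lfloor\frac{N+1}{1-1/s_{i+1}}\right\rfloor$ and $s_i=f\!\left(s_{i+1},1-\frac{N+1}{a_i}\right)$; if $i$ is even, $a_i=1+\left\lfloor\frac{N}{s_{i+1}}\right\rfloor$ and $s_i=g\!\left(s_{i+1},-\frac{N}{a_i}\right)$ — yields $a_r=2$ and $a_1=\cdots=a_{r-1}=1$, and $T_G(1,\ldots,1,2)$ is $(0,N]$-eigenvalue free. Consequently, no threshold graph $T_G(a_1,\ldots,a_r)$ with $r$ odd, $a_r\ge 2$ and $a_i\ge 1$ for $1\le i\le r-1$ has an eigenvalue in the interval $(0,N]$.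
   Context: All graphs are finite, simple and undirected; eigenvalues are those of the adjacency matrix. A graph is $I$-eigenvalue free if it has no eigenvalue in the interval $I$. For an integer $r\ge 1$ and positive integers $a_1,\ldots,a_r$ with $a_r\ge 2$, the threshold graph $T_G(a_1,\ldots,a_r)$ is defined as follows: start with $G_r=K_{a_r}$ if $r$ is odd and $G_r=\overline{K_{a_r}}$ if $r$ is even; for $i=r-1,\ldots,1$, obtain $G_i$ from $G_{i+1}$ by adding $a_i$ new vertices adjacent to each other and to all vertices of $G_{i+1}$ if $i$ is odd, and $a_i$ new isolated vertices if $i$ is even; then $T_G(a_1,\ldots,a_r)=G_1$. Here $f(X,Y)=\frac{XY-1}{X+Y-2}$ and $g(X,Y)=\frac{XY}{X+Y}$. *)

theory Defs
  imports
    Complex_Main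
    "Graph_Theory.Pair_Digraph"
    "Jordan_Normal_Form.Char_Poly"
begin

text \<open>
  A finite simple undirected graph is a symmetric loop-free finite digraph, i.e. a
  \<open>pair_graph\<close>; an edge \<open>uv\<close> is the pair of arcs \<open>(u,v)\<close>, \<open>(v,u)\<close>.
\<close>

definition complete_graph :: "nat \<Rightarrow> nat pair_pre_digraph" where
  "complete_graph k = \<lparr> pverts = {..<k}, parcs = {(u, v). u < k \<and> v < k \<and> u \<noteq> v} \<rparr>"

definition empty_graph :: "nat \<Rightarrow> nat pair_pre_digraph" where
  "empty_graph k = \<lparr> pverts = {..<k}, parcs = {} \<rparr>"

text \<open>The first \<open>k\<close> natural numbers beyond all vertices of the graph.\<close>

definition new_verts :: "nat \<Rightarrow> nat pair_pre_digraph \<Rightarrow> nat set" where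
  "new_verts k G = (let n = (LEAST n. \<forall>v \<in> pverts G. v < n) in {n..<n + k})"

definition add_dominating :: "nat \<Rightarrow> nat pair_pre_digraph \<Rightarrow> nat pair_pre_digraph" where
  "add_dominating k G =
    (let W = new_verts k G in
      \<lparr> pverts = pverts G \<union> W,
        parcs = parcs G \<union> {(u, v). u \<in> W \<and> v \<in> W \<and> u \<noteq> v}
                  \<union> W \<times> pverts G \<union> pverts G \<times> W \<rparr>)"

definition add_isolated :: "nat \<Rightarrow> nat pair_pre_digraph \<Rightarrow> nat pair_pre_digraph" where
  "add_isolated k G = \<lparr> pverts = pverts G \<union> new_verts k G, parcs = parcs G \<rparr>"

text \<open>
  \<open>threshold_stage r a i\<close> is \<open>G\<^sub>i\<close>, for \<open>1 \<le> i \<le> r\<close>;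
  the parameters \<open>a\<^sub>1, \<dots>, a\<^sub>r\<close> are \<open>a 1, \<dots>, a r\<close>, other values of \<open>a\<close> are irrelevant.
\<close>

function threshold_stage :: "nat \<Rightarrow> (nat \<Rightarrow> nat) \<Rightarrow> nat \<Rightarrow> nat pair_pre_digraph" where
  "threshold_stage r a i =
    (if r \<le> i then (if odd r then complete_graph (a r) else empty_graph (a r))
     else if odd i then add_dominating (a i) (threshold_stage r a (i + 1))
     else add_isolated (a i) (threshold_stage r a (i + 1)))"
  by auto
termination by (relation "measure (\<lambda>(r, a, i). r - i)") auto

declare threshold_stage.simps [simp del]

definition threshold_graph :: "nat \<Rightarrow> (nat \<Rightarrow> nat) \<Rightarrow> nat pair_pre_digraph" where
  "threshold_graph r a = threshold_stage r a 1"

definition adjacency_matrix :: "'v::linorder pair_pre_digraph \<Rightarrow> real mat" where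
  "adjacency_matrix G =
    (let vs = sorted_list_of_set (pverts G)
     in mat (length vs) (length vs)
          (\<lambda>(i, j). if (vs ! i, vs ! j) \<in> parcs G then 1 else 0))"

definition eigenvalue_free :: "real set \<Rightarrow> 'v::linorder pair_pre_digraph \<Rightarrow> bool" where
  "eigenvalue_free I G \<longleftrightarrow> (\<forall>x \<in> I. \<not> eigenvalue (adjacency_matrix G) x)"

definition f_step :: "real \<Rightarrow> real \<Rightarrow> real" where
  "f_step X Y = (X * Y - 1) / (X + Y - 2)"

definition g_step :: "real \<Rightarrow> real \<Rightarrow> real" where
  "g_step X Y = X * Y / (X + Y)"

text \<open>
  \<open>greedy_run N r a s\<close>: the numbers \<open>a r, \<dots>, a 1\<close> and \<open>s r, \<dots>, s 1\<close> are produced by the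
  procedure that picks the smallest allowed integer at each step. All quotients that the
  procedure evaluates are required to have nonzero denominators, since division by zero
  would otherwise silently yield 0.
\<close>

definition greedy_run :: "real \<Rightarrow> nat \<Rightarrow> (nat \<Rightarrow> nat) \<Rightarrow> (nat \<Rightarrow> real) \<Rightarrow> bool" where
  "greedy_run N r a s \<longleftrightarrow>
    (\<forall>i \<in> {1..r}. 0 < a i) \<and>
    int (a r) = (LEAST m::int. 1 + \<lfloor>N + 1\<rfloor> \<le> m) \<and>
    s r = 1 - (N + 1) / real (a r) \<and>
    (\<forall>i \<in> {1..<r}. odd i \<longrightarrow>
      s (i + 1) \<noteq> 0 \<and> 1 - 1 / s (i + 1) \<noteq> 0 \<and>
      int (a i) = 1 + \<lfloor>(N + 1) / (1 - 1 / s (i + 1))\<rfloor> \<and>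
      s (i + 1) + (1 - (N + 1) / real (a i)) - 2 \<noteq> 0 \<and>
      s i = f_step (s (i + 1)) (1 - (N + 1) / real (a i))) \<and>
    (\<forall>i \<in> {1..<r}. even i \<longrightarrow>
      s (i + 1) \<noteq> 0 \<and>
      int (a i) = 1 + \<lfloor>N / s (i + 1)\<rfloor> \<and>
      s (i + 1) + - (N / real (a i)) \<noteq> 0 \<and>
      s i = g_step (s (i + 1)) (- (N / real (a i))))"

lemma threshold_graph_pair_graph: "pair_graph (threshold_graph r a)"
proof -
  have complete: "pair_graph (complete_graph k)" for k
  proof -
    have "finite {(u, v). u < k \<and> v < k \<and> u \<noteq> v}"
      by (rule finite_subset[of _ "{..<k} \<times> {..<k}"]) auto
    then show ?thesis
      by unfold_locales (auto simp: complete_graph_def symmetric_def sym_def)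
  qed
  have empty: "pair_graph (empty_graph k)" for k
    by unfold_locales (auto simp: empty_graph_def symmetric_def sym_def)
  have fin: "finite (new_verts k G)" for k G
    by (simp add: new_verts_def Let_def)
  have new: "v \<notin> new_verts k G" if "pair_graph G" "v \<in> pverts G" for v k G
  proof -
    interpret pair_graph G by fact
    have "\<forall>v \<in> pverts G. v < Suc (Max (pverts G))"
      using pair_finite_verts by (simp add: less_Suc_eq_le)
    then have "\<forall>v \<in> pverts G. v < (LEAST n. \<forall>v \<in> pverts G. v < n)"
      by (rule LeastI)
    with that show ?thesis by (force simp: new_verts_def Let_def)
  qed
  have dom: "pair_graph (add_dominating k G)" if "pair_graph G" for k G
  proof -
    interpret pair_graph G by fact
    let ?W = "new_verts k G"
    have "finite {(u, v). u \<in> ?W \<and> v \<in> ?W \<and> u \<noteq> v}"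
      by (rule finite_subset[of _ "?W \<times> ?W"]) (auto simp: fin)
    moreover have "sym (parcs G)" using pair_sym_arcs by (simp add: symmetric_def)
    ultimately show ?thesis
      using pair_finite_verts pair_finite_arcs pair_no_loops new[OF that]
      by unfold_locales
        (auto simp: add_dominating_def Let_def symmetric_def sym_def fin
              dest: in_arcsD1 in_arcsD2)
  qed
  have iso: "pair_graph (add_isolated k G)" if "pair_graph G" for k G
  proof -
    interpret pair_graph G by fact
    have "sym (parcs G)" using pair_sym_arcs by (simp add: symmetric_def)
    then show ?thesis
      using pair_finite_verts pair_finite_arcs pair_no_loops
      by unfold_locales
        (auto simp: add_isolated_def symmetric_def fin dest: in_arcsD1 in_arcsD2)
  qed
  have "pair_graph (threshold_stage r a i)" for i
  proof (induction r a i rule: threshold_stage.induct)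
    case (1 r a i)
    then show ?case
      by (subst threshold_stage.simps) (auto simp: complete empty dom iso)
  qed
  then show ?thesis by (simp add: threshold_graph_def)
qed

end

theory Submission
  imports Defs
begin

text \<open>
  Let \<open>x \<in> (0, N]\<close>. For \<open>w\<close> on the vertices of \<open>G\<^sub>i\<close> and a constant \<open>C\<close> (the total weight of the
  dominating vertices added later), consider \<open>A(G\<^sub>i) w + C \<cdot> 1 = x w\<close>. Summing over the vertices
  gives \<open>C = - s\<^sub>i \<Sum>w\<close>, where \<open>s\<^sub>i\<close> obeys the recursion of the procedure with \<open>x\<close> in place of \<open>N\<close>.
  The choice of \<open>N\<close> makes \<open>1 - \<surd>2/2\<close> a (double) fixed point of two consecutive steps, and for every
  \<open>x \<le> N\<close> and all parameters \<open>a\<^sub>i\<close> the bounds \<open>s\<^sub>i \<ge> 1 - \<surd>2/2\<close> (\<open>i\<close> odd) and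
  \<open>-\<surd>2/2 \<le> s\<^sub>i < 0\<close> (\<open>i\<close> even) persist. In particular \<open>s\<^sub>1 \<noteq> 0\<close>; an eigenvector for \<open>x\<close> has \<open>C = 0\<close>
  at \<open>i = 1\<close>, hence total weight zero, and this forces it to vanish stage by stage.
\<close>

section \<open>Invariant bounds for the two recursion steps\<close>

text \<open>Its reciprocal is \<open>2 + 2 * sqrt 2\<close>, and that of
  \<open>threshold_bound + 1\<close> is \<open>2 * sqrt 2 - 2\<close>. These values make the
  estimates of both steps close up at \<open>sqrt 2\<close>.\<close>

definition threshold_bound :: real where
  "threshold_bound = (- 1 + sqrt 2) / 2"

lemma sqrt_2_bounds: "14 / 10 < sqrt 2" "sqrt 2 < 15 / 10"
  by (rule real_less_rsqrt, simp add: power2_eq_square)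
    (rule real_less_lsqrt, simp_all add: power2_eq_square)

lemma threshold_bound_pos: "0 < threshold_bound"
  using sqrt_2_bounds by (simp add: threshold_bound_def)

lemma odd_start_bound:
  assumes "0 < x" "x \<le> threshold_bound" "2 \<le> k"
  shows "1 - sqrt 2 / 2 \<le> 1 - (x + 1) / real k"
proof -
  have "(x + 1) / real k \<le> (x + 1) / 2"
    using assms by (intro divide_left_mono) auto
  also have "\<dots> \<le> sqrt 2 / 2"
    using assms sqrt_2_bounds by (simp add: threshold_bound_def)
  finally show ?thesis by simp
qed

text \<open>With \<open>y = x / k\<close> the step is additive in reciprocals:
  \<open>1 / g = 1 / s - 1 / y\<close>. Here \<open>1 / s\<close> is at most
  \<open>2 + sqrt 2\<close> and \<open>1 / y\<close> is at least \<open>2 + 2 * sqrt 2\<close>, so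
  \<open>1 / g\<close> is at most \<open>- sqrt 2\<close>.\<close>

lemma g_step_bounds:
  assumes "0 < x" "x \<le> threshold_bound" "1 \<le> k" and s: "1 - sqrt 2 / 2 \<le> s"
  shows "x / real k < s" "- (sqrt 2 / 2) \<le> g_step s (- (x / real k))"
    "g_step s (- (x / real k)) < 0"
    "1 / g_step s (- (x / real k)) = 1 / s - real k / x"
proof -
  define y where "y = x / real k"
  have "y \<le> x / 1" unfolding y_def using assms by (intro divide_left_mono) auto
  moreover have "0 < y" using assms by (simp add: y_def)
  ultimately have y: "0 < y" "y \<le> (sqrt 2 - 1) / 2"
    using assms by (auto simp: threshold_bound_def)
  have s0: "0 < s" and ys: "y < s" using s y sqrt_2_bounds by auto
  show "x / real k < s" using ys by (simp add: y_def)
  have g: "g_step s (- y) = - (s * y / (s - y))" by (simp add: g_step_def)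
  show "g_step s (- (x / real k)) < 0"
    unfolding y_def[symmetric] g using s0 y ys by simp
  have "1 / g_step s (- y) = 1 / s - 1 / y"
    unfolding g using s0 y ys by (simp add: field_simps)
  then show "1 / g_step s (- (x / real k)) = 1 / s - real k / x"
    by (simp add: y_def)
  have "1 / s \<le> 1 / (1 - sqrt 2 / 2)"
    using s sqrt_2_bounds by (intro divide_left_mono) auto
  also have "\<dots> = 2 + sqrt 2"
    using sqrt_2_bounds by (simp add: field_simps)
  finally have 1: "1 / s \<le> 2 + sqrt 2" .
  have "2 * sqrt 2 + 2 = 1 / ((sqrt 2 - 1) / 2)"
    using sqrt_2_bounds by (simp add: field_simps)
  also have "\<dots> \<le> 1 / y"
    using y by (intro divide_left_mono) auto
  finally have "sqrt 2 \<le> 1 / y - 1 / s" using 1 by simp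
  also have "\<dots> = (s - y) / (s * y)" using s0 y by (simp add: field_simps)
  finally have "sqrt 2 * (s * y) \<le> s - y"
    using s0 y by (simp add: pos_le_divide_eq)
  \<comment> \<open>The extra factor turns \<open>sqrt 2 * sqrt 2\<close> into 2, so that dividing
    by \<open>2 * (s - y)\<close> gives the bound in the form \<open>sqrt 2 / 2\<close>.\<close>
  then have "sqrt 2 * (sqrt 2 * (s * y)) \<le> sqrt 2 * (s - y)"
    by (intro mult_left_mono) auto
  then have "2 * (s * y) \<le> sqrt 2 * (s - y)"
    by (simp add: mult.assoc[symmetric])
  then have "s * y / (s - y) \<le> sqrt 2 / 2"
    using ys by (simp add: pos_divide_le_eq)
  then show "- (sqrt 2 / 2) \<le> g_step s (- (x / real k))"
    unfolding y_def[symmetric] g by simp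
qed

text \<open>In the variables \<open>p = 1 - s\<close> and \<open>d = (x + 1) / k\<close> this step
  is additive in reciprocals too: \<open>1 / (1 - f) = 1 / p + 1 / d\<close>. The summands are at
  least \<open>2 - sqrt 2\<close> and \<open>2 * sqrt 2 - 2\<close>, so \<open>1 - f\<close> is at
  most \<open>1 / sqrt 2\<close>.\<close>

lemma f_step_bounds:
  assumes "0 < x" "x \<le> threshold_bound" "1 \<le> k" and s: "- (sqrt 2 / 2) \<le> s" "s < 0"
  shows "1 - sqrt 2 / 2 \<le> f_step s (1 - (x + 1) / real k)"
    "f_step s (1 - (x + 1) / real k) < 1"
    "1 / (1 - f_step s (1 - (x + 1) / real k)) = 1 / (1 - s) + real k / (x + 1)"
proof -
  define d where "d = (x + 1) / real k"
  have "d \<le> (x + 1) / 1" unfolding d_def using assms by (intro divide_left_mono) auto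
  moreover have "0 < d" using assms by (simp add: d_def)
  ultimately have d: "0 < d" "d \<le> (sqrt 2 + 1) / 2"
    using assms by (auto simp: threshold_bound_def)
  define p where "p = 1 - s"
  have p: "0 < p" "p \<le> 1 + sqrt 2 / 2" using s by (auto simp: p_def)
  have f: "1 - f_step s (1 - d) = p * d / (p + d)"
    using p d by (simp add: f_step_def p_def field_simps)
  have inv: "1 / (1 - f_step s (1 - d)) = 1 / p + 1 / d"
    unfolding f using p d by (simp add: field_simps)
  then show "1 / (1 - f_step s (1 - (x + 1) / real k)) = 1 / (1 - s) + real k / (x + 1)"
    by (simp add: d_def p_def)
  have "0 < 1 - f_step s (1 - d)" unfolding f using p d by simp
  then show "f_step s (1 - (x + 1) / real k) < 1" by (simp add: d_def)
  have "2 - sqrt 2 = 1 / (1 + sqrt 2 / 2)"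
    using sqrt_2_bounds by (simp add: field_simps)
  also have "\<dots> \<le> 1 / p" using p by (intro divide_left_mono) auto
  finally have 1: "2 - sqrt 2 \<le> 1 / p" .
  have "2 * sqrt 2 - 2 = 1 / ((sqrt 2 + 1) / 2)"
    using sqrt_2_bounds by (simp add: field_simps)
  also have "\<dots> \<le> 1 / d" using d by (intro divide_left_mono) auto
  finally have "sqrt 2 \<le> 1 / p + 1 / d" using 1 by simp
  also have "\<dots> = (p + d) / (p * d)" using p d by (simp add: field_simps)
  finally have "sqrt 2 * (p * d) \<le> p + d"
    using p d by (simp add: pos_le_divide_eq)
  then have "sqrt 2 * (sqrt 2 * (p * d)) \<le> sqrt 2 * (p + d)"
    by (intro mult_left_mono) auto
  then have "2 * (p * d) \<le> sqrt 2 * (p + d)"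
    by (simp add: mult.assoc[symmetric])
  then have "p * d / (p + d) \<le> sqrt 2 / 2"
    using p d by (simp add: pos_divide_le_eq)
  then show "1 - sqrt 2 / 2 \<le> f_step s (1 - (x + 1) / real k)"
    unfolding d_def[symmetric] using f by linarith
qed

section \<open>Total weight of solutions of the shifted eigenvalue equation\<close>

definition neighbour_sum :: "'v pair_pre_digraph \<Rightarrow> ('v \<Rightarrow> real) \<Rightarrow> 'v \<Rightarrow> real" where
  "neighbour_sum G w u = (\<Sum>v \<in> pverts G. if (u, v) \<in> parcs G then w v else 0)"

text \<open>For a finite graph with adjacency matrix \<open>A\<close> this says that
  \<open>A - x I\<close> is invertible and that \<open>s\<close> is the reciprocal of the sum of all
  entries of its inverse. Quantifying over the solutions \<open>w\<close> avoids inverse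
  matrices.\<close>

definition response :: "real \<Rightarrow> real \<Rightarrow> 'v pair_pre_digraph \<Rightarrow> bool" where
  "response x s G \<longleftrightarrow> (\<forall>w C. (\<forall>u \<in> pverts G. neighbour_sum G w u + C = x * w u) \<longrightarrow>
     C = - s * sum w (pverts G) \<and> (C = 0 \<longrightarrow> (\<forall>u \<in> pverts G. w u = 0)))"

lemma responseD:
  assumes "response x s G" "\<And>u. u \<in> pverts G \<Longrightarrow> neighbour_sum G w u + C = x * w u"
  shows "C = - s * sum w (pverts G)" "C = 0 \<Longrightarrow> u \<in> pverts G \<Longrightarrow> w u = 0"
  using assms unfolding response_def by blast+

definition wf_finite :: "'v pair_pre_digraph \<Rightarrow> bool" where
  "wf_finite G \<longleftrightarrow> finite (pverts G) \<and> parcs G \<subseteq> pverts G \<times> pverts G"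

lemma new_verts_fresh:
  assumes "finite (pverts G)"
  shows "finite (new_verts k G)" "card (new_verts k G) = k" "pverts G \<inter> new_verts k G = {}"
proof -
  show "finite (new_verts k G)" "card (new_verts k G) = k"
    by (simp_all add: new_verts_def Let_def)
  \<comment> \<open>Some upper bound must exist for \<open>LEAST\<close> to be meaningful. For an
    empty vertex set the value of \<open>Max\<close> is unspecified, but the claim is
    vacuous.\<close>
  have "\<forall>v \<in> pverts G. v < Suc (Max (pverts G))"
    using assms by (simp add: less_Suc_eq_le)
  then have "\<forall>v \<in> pverts G. v < (LEAST n. \<forall>v \<in> pverts G. v < n)"
    by (rule LeastI)
  then show "pverts G \<inter> new_verts k G = {}"
    by (force simp: new_verts_def Let_def)
qed

lemma sum_off_diagonal:
  fixes w :: "'v \<Rightarrow> real"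
  assumes "finite A" "u \<in> A"
  shows "(\<Sum>v \<in> A. if u \<noteq> v then w v else 0) = sum w A - w u"
proof -
  have "(\<Sum>v \<in> A. if u \<noteq> v then w v else 0) = (\<Sum>v \<in> A. w v - (if u = v then w v else 0))"
    by (rule sum.cong) auto
  then show ?thesis using assms by (simp add: sum_subtractf)
qed

lemma wf_finite_add_isolated: "wf_finite G \<Longrightarrow> wf_finite (add_isolated k G)"
  using new_verts_fresh(1)[of G k] by (auto simp: wf_finite_def add_isolated_def)

lemma wf_finite_add_dominating: "wf_finite G \<Longrightarrow> wf_finite (add_dominating k G)"
  using new_verts_fresh(1)[of G k] by (auto simp: wf_finite_def add_dominating_def Let_def)

text \<open>Every vertex equation becomes \<open>(x + 1) * w u = S + C\<close> with \<open>S\<close>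
  the total weight, so \<open>w\<close> is constant and summation over the \<open>k\<close> vertices
  determines \<open>C\<close>.\<close>

lemma response_complete_graph:
  assumes "0 < x" "1 \<le> k" and s: "1 - (x + 1) / real k \<noteq> 0"
  shows "response x (1 - (x + 1) / real k) (complete_graph k)"
  unfolding response_def
proof (intro allI impI)
  fix w :: "nat \<Rightarrow> real" and C
  let ?V = "pverts (complete_graph k)"
  let ?S = "sum w ?V"
  assume eq: "\<forall>u \<in> ?V. neighbour_sum (complete_graph k) w u + C = x * w u"
  have V: "?V = {..<k}" by (simp add: complete_graph_def)
  have loc: "(x + 1) * w u = ?S + C" if "u \<in> ?V" for u
  proof -
    have "neighbour_sum (complete_graph k) w u = (\<Sum>v \<in> ?V. if u \<noteq> v then w v else 0)"
      unfolding neighbour_sum_def using that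
      by (intro sum.cong) (auto simp: complete_graph_def)
    also have "\<dots> = ?S - w u" using that V by (intro sum_off_diagonal) auto
    finally show ?thesis using bspec[OF eq that] by (simp add: algebra_simps)
  qed
  have "(x + 1) * ?S = real k * (?S + C)"
    unfolding sum_distrib_left using loc V by simp
  then have C: "C = - (1 - (x + 1) / real k) * ?S"
    using assms by (simp add: field_simps)
  have "w u = 0" if "C = 0" "u \<in> ?V" for u
  proof -
    have "(1 - (x + 1) / real k) * ?S = 0" using C that(1) by linarith
    with s have "?S = 0" by (simp only: mult_eq_0_iff simp_thms)
    then show ?thesis using loc[of u] that assms by simp
  qed
  with C show "C = - (1 - (x + 1) / real k) * ?S \<and> (C = 0 \<longrightarrow> (\<forall>u \<in> ?V. w u = 0))"
    by blast
qed

text \<open>Old vertices keep their equation with the same \<open>C\<close>, and each new vertex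
  carries weight \<open>C / x\<close>. The total is \<open>- C / s + k * C / x\<close>, which
  explains the reciprocal form of the condition on \<open>s'\<close>.\<close>

lemma response_add_isolated:
  assumes G: "wf_finite G" "response x s G" and x: "x \<noteq> 0" and s: "s \<noteq> 0"
    and s': "1 / s' = 1 / s - real k / x" "s' \<noteq> 0"
  shows "response x s' (add_isolated k G)"
  unfolding response_def
proof (intro allI impI)
  fix w :: "nat \<Rightarrow> real" and C
  let ?H = "add_isolated k G" and ?W = "new_verts k G"
  assume eq: "\<forall>u \<in> pverts ?H. neighbour_sum ?H w u + C = x * w u"
  have fin: "finite (pverts G)" and arcs: "parcs G \<subseteq> pverts G \<times> pverts G"
    using G by (auto simp: wf_finite_def)
  note W = new_verts_fresh[OF fin, of k]
  have V: "pverts ?H = pverts G \<union> ?W" by (simp add: add_isolated_def)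
  have split: "sum h (pverts ?H) = sum h (pverts G) + sum h ?W" for h :: "nat \<Rightarrow> real"
    unfolding V using fin W by (intro sum.union_disjoint)
  have nbr: "neighbour_sum ?H w u = neighbour_sum G w u" for u
  proof -
    have "(\<Sum>v \<in> ?W. if (u, v) \<in> parcs ?H then w v else 0) = 0"
      using arcs W(3) by (intro sum.neutral) (auto simp: add_isolated_def)
    then show ?thesis
      unfolding neighbour_sum_def split by (simp add: add_isolated_def)
  qed
  have old: "neighbour_sum G w u + C = x * w u" if "u \<in> pverts G" for u
    using eq nbr V that by auto
  have new: "w u = C / x" if "u \<in> ?W" for u
  proof -
    have "neighbour_sum G w u = 0"
      unfolding neighbour_sum_def using arcs W(3) that by (intro sum.neutral) auto
    moreover have "neighbour_sum G w u + C = x * w u" using eq nbr V that by auto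
    ultimately show ?thesis using x by (simp add: field_simps)
  qed
  have "sum w (pverts G) = - C * (1 / s)"
    using responseD(1)[OF G(2) old] s by simp
  moreover have "sum w ?W = real k * (C / x)" using new W(2) by simp
  ultimately have "sum w (pverts ?H) = - C * (1 / s')"
    unfolding split s'(1) by (simp add: algebra_simps)
  then have "C = - s' * sum w (pverts ?H)" using s'(2) by simp
  moreover have "w u = 0" if "C = 0" "u \<in> pverts ?H" for u
    using that responseD(2)[OF G(2) old] new V by auto
  ultimately show "C = - s' * sum w (pverts ?H) \<and> (C = 0 \<longrightarrow> (\<forall>u \<in> pverts ?H. w u = 0))"
    by blast
qed

text \<open>This is the isolated case seen in the complement: complementing replaces
  \<open>s\<close> by \<open>1 - s\<close> and \<open>x\<close> by \<open>- 1 - x\<close>. Directly,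
  the old vertices see the constant \<open>C + sum w ?W\<close>, while each new vertex has weight
  \<open>(?S + C) / (x + 1)\<close>.\<close>

lemma response_add_dominating:
  assumes G: "wf_finite G" "response x s G" and x: "x + 1 \<noteq> 0" and s: "s \<noteq> 1"
    and s': "1 / (1 - s') = 1 / (1 - s) + real k / (x + 1)" "s' \<noteq> 0" "s' \<noteq> 1"
  shows "response x s' (add_dominating k G)"
  unfolding response_def
proof (intro allI impI)
  fix w :: "nat \<Rightarrow> real" and C
  let ?H = "add_dominating k G" and ?W = "new_verts k G"
  let ?S = "sum w (pverts ?H)"
  assume eq: "\<forall>u \<in> pverts ?H. neighbour_sum ?H w u + C = x * w u"
  have fin: "finite (pverts G)" and arcs: "parcs G \<subseteq> pverts G \<times> pverts G"
    using G by (auto simp: wf_finite_def)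
  note W = new_verts_fresh[OF fin, of k]
  have V: "pverts ?H = pverts G \<union> ?W" by (simp add: add_dominating_def Let_def)
  have split: "sum h (pverts ?H) = sum h (pverts G) + sum h ?W" for h :: "nat \<Rightarrow> real"
    unfolding V using fin W by (intro sum.union_disjoint)
  have old: "neighbour_sum G w u + (C + sum w ?W) = x * w u" if u: "u \<in> pverts G" for u
  proof -
    have "(\<Sum>v \<in> ?W. if (u, v) \<in> parcs ?H then w v else 0) = sum w ?W"
      using u by (intro sum.cong) (auto simp: add_dominating_def Let_def)
    moreover have "(\<Sum>v \<in> pverts G. if (u, v) \<in> parcs ?H then w v else 0) = neighbour_sum G w u"
      unfolding neighbour_sum_def using u W(3)
      by (intro sum.cong) (auto simp: add_dominating_def Let_def)
    ultimately have "neighbour_sum ?H w u = neighbour_sum G w u + sum w ?W"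
      by (simp add: neighbour_sum_def split)
    moreover have "neighbour_sum ?H w u + C = x * w u" using eq u V by auto
    ultimately show ?thesis by simp
  qed
  have new: "w u = (?S + C) / (x + 1)" if u: "u \<in> ?W" for u
  proof -
    have "neighbour_sum ?H w u = (\<Sum>v \<in> pverts ?H. if u \<noteq> v then w v else 0)"
      unfolding neighbour_sum_def using u W(3) arcs
      by (intro sum.cong) (auto simp: add_dominating_def Let_def)
    also have "\<dots> = ?S - w u"
      using fin W u V by (intro sum_off_diagonal) auto
    finally have "neighbour_sum ?H w u = ?S - w u" .
    moreover have "neighbour_sum ?H w u + C = x * w u" using eq u V by auto
    ultimately have "w u * (x + 1) = ?S + C" by (simp add: algebra_simps)
    then show ?thesis using x by (simp add: eq_divide_eq)
  qed
  have resp: "C + sum w ?W = - s * sum w (pverts G)"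
    by (rule responseD(1)[OF G(2) old])
  then have "(1 - s) * sum w (pverts G) = ?S + C"
    using split[of w] by (simp add: algebra_simps)
  then have inner: "sum w (pverts G) = (?S + C) * (1 / (1 - s))"
    using s by (simp add: field_simps)
  have "sum w ?W = (?S + C) * (real k / (x + 1))" using new W(2) by simp
  then have "?S = (?S + C) * (1 / (1 - s'))"
    using inner split[of w] unfolding s'(1) distrib_left[of "?S + C"] by linarith
  then have "?S * (1 - s') = ?S + C" using s'(3) by (simp add: field_simps)
  then have C: "C = - s' * ?S" by (simp add: algebra_simps)
  have "w u = 0" if "C = 0" "u \<in> pverts ?H" for u
  proof -
    \<comment> \<open>As \<open>s'\<close> is nonzero, \<open>C = 0\<close> forces total weight
      zero. Then the new weights and the old total vanish, so the constant seen by \<open>G\<close>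
      is zero and the hypothesis on \<open>G\<close> removes the old weights.\<close>
    have "?S + C = 0"
      using C that(1) s'(2) by (metis add_0_right mult_eq_0_iff neg_equal_0_iff_equal)
    then have inner0: "sum w (pverts G) = 0" and new0: "u \<in> ?W \<Longrightarrow> w u = 0"
      using inner new[of u] by simp_all
    have "C + sum w ?W = 0" using resp inner0 by simp
    note responseD(2)[OF G(2) old this]
    then show ?thesis using new0 that(2) V by blast
  qed
  with C show "C = - s' * ?S \<and> (C = 0 \<longrightarrow> (\<forall>u \<in> pverts ?H. w u = 0))"
    by blast
qed

section \<open>Induction over the stages and absence of eigenvalues\<close>

text \<open>The bounds for odd and even stages imply each other in turn. They also keep
  \<open>s\<close> away from the values 0 and 1 at which a recursion step would break down.\<close>

lemma threshold_stage_response: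
  assumes x: "0 < x" "x \<le> threshold_bound" and r: "odd r"
    and a: "2 \<le> a r" "\<And>i. i \<in> {1..<r} \<Longrightarrow> 1 \<le> a i"
    and i: "1 \<le> i" "i \<le> r"
  shows "wf_finite (threshold_stage r a i) \<and>
    (\<exists>s. response x s (threshold_stage r a i) \<and>
      (if odd i then 1 - sqrt 2 / 2 \<le> s else - (sqrt 2 / 2) \<le> s \<and> s < 0))"
  using i(2,1)
proof (induction i rule: inc_induct)
  case base
  have stage: "threshold_stage r a r = complete_graph (a r)"
    using r by (simp add: threshold_stage.simps)
  have s: "1 - sqrt 2 / 2 \<le> 1 - (x + 1) / real (a r)"
    by (rule odd_start_bound[OF x a(1)])
  then have "1 - (x + 1) / real (a r) \<noteq> 0" using sqrt_2_bounds by linarith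
  then have "response x (1 - (x + 1) / real (a r)) (complete_graph (a r))"
    using x a by (intro response_complete_graph) auto
  moreover have "wf_finite (complete_graph (a r))"
    by (auto simp: wf_finite_def complete_graph_def)
  ultimately show ?case using r s stage by auto
next
  case (step i)
  let ?G = "threshold_stage r a (Suc i)"
  have k: "1 \<le> a i" using a step by auto
  obtain s where G: "wf_finite ?G" "response x s ?G"
    and s: "if odd (Suc i) then 1 - sqrt 2 / 2 \<le> s else - (sqrt 2 / 2) \<le> s \<and> s < 0"
    using step by auto
  show ?case
  proof (cases "odd i")
    case True
    have stage: "threshold_stage r a i = add_dominating (a i) ?G"
      using True step by (subst threshold_stage.simps) auto
    have s: "- (sqrt 2 / 2) \<le> s" "s < 0" using s True by auto
    note f = f_step_bounds[OF x k s]
    have "response x (f_step s (1 - (x + 1) / real (a i))) (add_dominating (a i) ?G)"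
      using f s x sqrt_2_bounds by (intro response_add_dominating[OF G _ _ f(3)]) auto
    then show ?thesis
      using True f(1) wf_finite_add_dominating[OF G(1)] unfolding stage by auto
  next
    case False
    have stage: "threshold_stage r a i = add_isolated (a i) ?G"
      using False step by (subst threshold_stage.simps) auto
    have s: "1 - sqrt 2 / 2 \<le> s" using s False by auto
    note g = g_step_bounds[OF x k s]
    have "response x (g_step s (- (x / real (a i)))) (add_isolated (a i) ?G)"
      using g s x sqrt_2_bounds by (intro response_add_isolated[OF G _ _ g(4)]) auto
    then show ?thesis
      using False g(2,3) wf_finite_add_isolated[OF G(1)] unfolding stage by auto
  qed
qed

text \<open>The sorted vertex list is a bijection from matrix indices to vertices; transporting an
  eigenvector along it gives weights on the vertices.\<close>

lemma eigenvalue_adjacency_matrixE: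
  fixes G :: "'v::linorder pair_pre_digraph"
  assumes fin: "finite (pverts G)" and ev: "eigenvalue (adjacency_matrix G) x"
  obtains w u where "\<And>u. u \<in> pverts G \<Longrightarrow> neighbour_sum G w u = x * w u"
    "u \<in> pverts G" "w u \<noteq> 0"
proof -
  define vs where "vs = sorted_list_of_set (pverts G)"
  define n where "n = length vs"
  have A: "adjacency_matrix G =
      mat n n (\<lambda>(i, j). if (vs ! i, vs ! j) \<in> parcs G then 1 else 0)"
    by (simp add: adjacency_matrix_def vs_def n_def Let_def)
  obtain v where v: "v \<in> carrier_vec n" "v \<noteq> 0\<^sub>v n" "adjacency_matrix G *\<^sub>v v = x \<cdot>\<^sub>v v"
    using ev by (auto simp: eigenvalue_def eigenvector_def A)
  have bij: "bij_betw ((!) vs) {..<n} (pverts G)"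
    using fin by (intro bij_betw_nth) (auto simp: vs_def n_def)
  define w where "w u = v $ the_inv_into {..<n} ((!) vs) u" for u
  have w: "w (vs ! i) = v $ i" if "i < n" for i
    using bij that by (simp add: w_def the_inv_into_f_f bij_betw_def)
  have "neighbour_sum G w u = x * w u" if u: "u \<in> pverts G" for u
  proof -
    obtain i where i: "i < n" "u = vs ! i" using bij u by (auto simp: bij_betw_def)
    have "neighbour_sum G w u = (\<Sum>j<n. if (u, vs ! j) \<in> parcs G then w (vs ! j) else 0)"
      unfolding neighbour_sum_def by (rule sum.reindex_bij_betw[OF bij, symmetric])
    also have "\<dots> = (\<Sum>j<n. (if (vs ! i, vs ! j) \<in> parcs G then 1 else 0) * v $ j)"
      using i w by (intro sum.cong) auto
    also have "\<dots> = (adjacency_matrix G *\<^sub>v v) $ i"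
      using i v(1) by (simp add: A scalar_prod_def lessThan_atLeast0)
    also have "\<dots> = x * w u" using v i w by simp
    finally show ?thesis .
  qed
  moreover obtain i where "i < n" "v $ i \<noteq> 0"
    using v(1,2) by (auto simp: vec_eq_iff)
  then have "vs ! i \<in> pverts G" "w (vs ! i) \<noteq> 0"
    using w bij by (auto simp: bij_betw_def)
  ultimately show ?thesis using that by blast
qed

lemma threshold_graph_eigenvalue_free:
  assumes "odd r" "2 \<le> a r" "\<And>i. i \<in> {1..<r} \<Longrightarrow> 1 \<le> a i"
  shows "eigenvalue_free {0<..threshold_bound} (threshold_graph r a)"
  unfolding eigenvalue_free_def
proof (intro ballI notI)
  fix x
  let ?G = "threshold_graph r a"
  assume x: "x \<in> {0<..threshold_bound}" and ev: "eigenvalue (adjacency_matrix ?G) x"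
  obtain s where G: "wf_finite ?G" "response x s ?G"
    \<comment> \<open>\<open>odd_pos\<close> ensures that 1 is among the stages up to
      \<open>r\<close>.\<close>
    using threshold_stage_response[of x r a 1] x assms odd_pos[of r]
    by (auto simp: threshold_graph_def)
  have "finite (pverts ?G)" using G by (simp add: wf_finite_def)
  then obtain w u where w: "\<And>u. u \<in> pverts ?G \<Longrightarrow> neighbour_sum ?G w u = x * w u"
    "u \<in> pverts ?G" "w u \<noteq> 0"
    using eigenvalue_adjacency_matrixE[OF _ ev] by blast
  then show False using responseD(2)[OF G(2), of w 0 u] by simp
qed

section \<open>The greedy procedure\<close>

text \<open>The bound on \<open>s\<close> exceeds \<open>threshold_bound\<close> (about 0.293
  against 0.207), so the quotient lies strictly between 0 and 1.\<close>

lemma floor_even_step: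
  assumes "1 - sqrt 2 / 2 \<le> s"
  shows "\<lfloor>threshold_bound / s\<rfloor> = 0"
proof -
  have "threshold_bound < s" "0 < s"
    using assms sqrt_2_bounds by (auto simp: threshold_bound_def)
  then show ?thesis using threshold_bound_pos by (simp add: floor_eq_iff)
qed

text \<open>The denominator is at least 2, whereas the numerator is about 1.207.\<close>

lemma floor_odd_step:
  assumes "- (sqrt 2 / 2) \<le> s" "s < 0"
  shows "\<lfloor>(threshold_bound + 1) / (1 - 1 / s)\<rfloor> = 0"
proof -
  have "1 \<le> - (1 / s)" using assms sqrt_2_bounds by (simp add: field_simps)
  then have "threshold_bound + 1 < 1 - 1 / s"
    using sqrt_2_bounds by (simp add: threshold_bound_def)
  then show ?thesis using threshold_bound_pos by (simp add: floor_eq_iff)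
qed

lemma least_start: "(LEAST m. 1 + \<lfloor>threshold_bound + 1\<rfloor> \<le> m) = 2"
proof -
  have "\<lfloor>threshold_bound + 1\<rfloor> = 1"
    using sqrt_2_bounds by (simp add: threshold_bound_def floor_eq_iff)
  then show ?thesis by (intro Least_equality) auto
qed

text \<open>The invariant of \<open>threshold_stage_response\<close> as a set, shared by the
  uniqueness and the existence proof for greedy runs.\<close>

definition step_range :: "nat \<Rightarrow> real set" where
  "step_range i = (if odd i then {1 - sqrt 2 / 2..} else {- (sqrt 2 / 2)..<0})"

text \<open>If \<open>s (i + 1)\<close> is in range, the floor is 0, hence \<open>a i = 1\<close>;
  the step bounds with \<open>x = threshold_bound\<close> and \<open>k = 1\<close> then put
  \<open>s i\<close> in range.\<close>

lemma greedy_run_determined: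
  assumes run: "greedy_run threshold_bound r a s" and r: "odd r" and i: "1 \<le> i" "i \<le> r"
  shows "a i = (if i = r then 2 else 1) \<and> s i \<in> step_range i"
  using i(2,1)
proof (induction i rule: inc_induct)
  case base
  have "a r = 2" using run unfolding greedy_run_def least_start by simp
  moreover have "s r = 1 - (threshold_bound + 1) / real (a r)"
    using run by (simp add: greedy_run_def)
  ultimately show ?case
    using odd_start_bound[of threshold_bound 2] threshold_bound_pos r
    by (simp add: step_range_def)
next
  case (step i)
  have i: "i \<in> {1..<r}" using step by auto
  have s: "s (Suc i) \<in> step_range (Suc i)" using step by auto
  show ?case
  proof (cases "odd i")
    case True
    then have s: "- (sqrt 2 / 2) \<le> s (Suc i)" "s (Suc i) < 0"
      using s by (auto simp: step_range_def)
    have "int (a i) = 1 + \<lfloor>(threshold_bound + 1) / (1 - 1 / s (Suc i))\<rfloor>"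
      and "s i = f_step (s (Suc i)) (1 - (threshold_bound + 1) / real (a i))"
      using run i True by (auto simp: greedy_run_def)
    then show ?thesis
      using floor_odd_step[OF s] f_step_bounds[of threshold_bound 1, OF _ _ _ s]
        threshold_bound_pos True i by (simp add: step_range_def)
  next
    case False
    then have s: "1 - sqrt 2 / 2 \<le> s (Suc i)"
      using s by (auto simp: step_range_def)
    have "int (a i) = 1 + \<lfloor>threshold_bound / s (Suc i)\<rfloor>"
      and "s i = g_step (s (Suc i)) (- (threshold_bound / real (a i)))"
      using run i False by (auto simp: greedy_run_def)
    then show ?thesis
      using floor_even_step[OF s] g_step_bounds[of threshold_bound 1, OF _ _ _ s]
        threshold_bound_pos False i by (simp add: step_range_def)
  qed
qed

text \<open>This keeps the claim about all greedy runs from being vacuous: along the expected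
  parameters no denominator vanishes.\<close>

lemma greedy_run_exists:
  assumes r: "odd r"
  shows "\<exists>a s. greedy_run threshold_bound r a s"
proof -
  let ?N = threshold_bound
  define a :: "nat \<Rightarrow> nat" where "a i = (if i = r then 2 else 1)" for i
  \<comment> \<open>The recursion runs over the distance \<open>d = r - i\<close>. Its step from
    \<open>d\<close> to \<open>Suc d\<close> produces stage \<open>i = r - Suc d\<close>, which has
    the parity of \<open>d\<close> because \<open>r\<close> is odd. With \<open>a i = 1\<close> the
    second argument of either step is \<open>- ?N\<close>.\<close>
  define S :: "nat \<Rightarrow> real" where
    "S = rec_nat (1 - (?N + 1) / 2) (\<lambda>d t. if odd d then f_step t (- ?N) else g_step t (- ?N))"
  define s where "s i = S (r - i)" for i
  have s_r: "s r = 1 - (?N + 1) / 2" by (simp add: s_def S_def)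
  have s_step: "s i = (if odd i then f_step (s (Suc i)) (- ?N) else g_step (s (Suc i)) (- ?N))"
    if "i < r" for i
  proof -
    obtain d where d: "r = Suc (i + d)" using \<open>i < r\<close> less_iff_Suc_add by auto
    then have "odd d \<longleftrightarrow> odd i" using r by auto
    with d show ?thesis by (simp add: s_def S_def)
  qed
  have range: "s i \<in> step_range i" if "i \<le> r" for i
    using that
  proof (induction i rule: inc_induct)
    case base
    show ?case
      using odd_start_bound[of ?N 2] threshold_bound_pos r s_r by (simp add: step_range_def)
  next
    case (step i)
    then show ?case
      using f_step_bounds[of ?N 1 "s (Suc i)"] g_step_bounds[of ?N 1 "s (Suc i)"]
        threshold_bound_pos s_step[of i]
      by (auto simp: step_range_def split: if_splits)
  qed
  have "greedy_run ?N r a s"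
    unfolding greedy_run_def
  proof (intro conjI ballI impI)
    show "int (a r) = (LEAST m::int. 1 + \<lfloor>?N + 1\<rfloor> \<le> m)" unfolding least_start by (simp add: a_def)
    show "s r = 1 - (?N + 1) / real (a r)" by (simp add: a_def s_r)
  next
    fix i assume i: "i \<in> {1..<r}" "odd i"
    then have s: "- (sqrt 2 / 2) \<le> s (i + 1)" "s (i + 1) < 0"
      using range[of "i + 1"] by (auto simp: step_range_def)
    have "1 / s (i + 1) < 0" using s by simp
    then show "s (i + 1) \<noteq> 0" "1 - 1 / s (i + 1) \<noteq> 0" using s by auto
    show "int (a i) = 1 + \<lfloor>(?N + 1) / (1 - 1 / s (i + 1))\<rfloor>"
      using floor_odd_step[OF s] i by (simp add: a_def)
    show "s (i + 1) + (1 - (?N + 1) / real (a i)) - 2 \<noteq> 0"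
      using s i threshold_bound_pos by (simp add: a_def)
    show "s i = f_step (s (i + 1)) (1 - (?N + 1) / real (a i))"
      using s_step[of i] i by (simp add: a_def)
  next
    fix i assume i: "i \<in> {1..<r}" "even i"
    then have s: "1 - sqrt 2 / 2 \<le> s (i + 1)"
      using range[of "i + 1"] by (auto simp: step_range_def)
    then show "s (i + 1) \<noteq> 0" using sqrt_2_bounds by auto
    show "int (a i) = 1 + \<lfloor>?N / s (i + 1)\<rfloor>"
      using floor_even_step[OF s] i by (simp add: a_def)
    show "s (i + 1) + - (?N / real (a i)) \<noteq> 0"
      using g_step_bounds(1)[of ?N 1, OF _ _ _ s] i threshold_bound_pos by (simp add: a_def)
    show "s i = g_step (s (i + 1)) (- (?N / real (a i)))"
      using s_step[of i] i by (simp add: a_def)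
  qed (simp add: a_def)
  then show ?thesis by blast
qed

theorem theorem8:
  fixes N :: real and r :: nat
  assumes "N = (- 1 + sqrt 2) / 2" and "odd r"
  shows "(\<exists>a s. greedy_run N r a s) \<and>
    (\<forall>a s. greedy_run N r a s \<longrightarrow> a r = 2 \<and> (\<forall>i \<in> {1..<r}. a i = 1)) \<and>
    eigenvalue_free {0<..N} (threshold_graph r (\<lambda>i. if i = r then 2 else 1)) \<and>
    (\<forall>a. a r \<ge> 2 \<and> (\<forall>i \<in> {1..<r}. a i \<ge> 1) \<longrightarrow>
      eigenvalue_free {0<..N} (threshold_graph r a))"
proof -
  have N: "N = threshold_bound" using assms(1) by (simp add: threshold_bound_def)
  have "a r = 2 \<and> (\<forall>i \<in> {1..<r}. a i = 1)" if "greedy_run threshold_bound r a s" for a s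
    using greedy_run_determined[OF that assms(2)] odd_pos[OF assms(2)] by auto
  \<comment> \<open>The graph with parameters 1, ..., 1, 2 is an instance of the general eigenvalue
    statement.\<close>
  then show ?thesis
    unfolding N using greedy_run_exists[OF assms(2)] threshold_graph_eigenvalue_free[OF assms(2)]
    by auto
qed

end
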